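(* Suppose that $u:\mathbb{D}\to\mathbb{C}$ and $\varphi:\mathbb{D}\to\mathbb{D}$ are holomorphic functions and that the operator $W_{u,\varphi}:\mathcal{B}^{v_{\log}}\to H_{v_{\log}}^\infty$ is continuous. Then there exists a constant $C>0$ such that $$\|W_{u,\varphi}\|_e^{\mathcal{B}^{v_{\log}}\to H_{v_{\log}}^\infty}\le C\lim_{r\to1^-}\ \sup_{|\varphi(z)|>r}\frac{v_{\log}(z)}{w_{\log}(\varphi(z))}|u(z)|.$$
   Context: $\mathbb{D}$ is the open unit disk of $\mathbb{C}$ and $H(\mathbb{D})$ is the space of holomorphic functions on $\mathbb{D}$. A weight is a bounded, continuous, positive function $v:\mathbb{D}\to(0,\infty)$. For a weight $v$, $H_v^\infty$ is the Banach space of all $f\in H(\mathbb{D})$ with $\|f\|_{H_v^\infty}=\sup_{z\in\mathbb{D}}v(z)|f(z)|<\infty$, and $\mathcal{B}^v$ is the Banach space of all $f\in H(\mathbb{D})$ with $f'\in H_v^\infty$, normed by $\|f\|_{\mathcal{B}^v}=|f(0)|+\sup_{z\in\mathbb{D}}v(z)|f'(z)|$. The weights used are $v_{\log}(z)=(1-|z|)\log\left(\frac{2}{1-|z|}\right)$ and $w_{\log}(z)=\left[\log\log\left(\frac{4}{1-|z|^2}\right)\right]^{-1}$, $z\in\mathbb{D}$. For holomorphic $u:\mathbb{D}\to\mathbb{C}$ and $\varphi:\mathbb{D}\to\mathbb{D}$, $W_{u,\varphi}(f)=u\cdot(f\circ\varphi)$. The supremum is over $z\in\mathbb{D}$ with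 $|\varphi(z)|>r$; a supremum over the empty set is $0$. The essential norm of a continuous linear operator $T:X\to Y$ between Banach spaces is $\|T\|_e^{X\to Y}=\inf\{\|T-K\|^{X\to Y}: K:X\to Y \text{ compact linear operator}\}$, where $\|\cdot\|^{X\to Y}$ is the operator norm. *)

theory Defs
  imports "HOL-Complex_Analysis.Complex_Analysis"
begin

abbreviation disk :: "complex set" where
  "disk \<equiv> ball 0 1"

text \<open>
  A function on the disk is represented by its extension by zero to the whole plane. Thus distinct
  elements of the spaces below differ at some point of the disk, and the seminorms are norms.
\<close>

definition on_disk :: "(complex \<Rightarrow> complex) \<Rightarrow> complex \<Rightarrow> complex" where
  "on_disk f = (\<lambda>z. if z \<in> disk then f z else 0)"

definition hol_disk :: "(complex \<Rightarrow> complex) set" where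
  "hol_disk = {f. f holomorphic_on disk \<and> (\<forall>z. z \<notin> disk \<longrightarrow> f z = 0)}"

record fun_space =
  fs_set :: "(complex \<Rightarrow> complex) set"
  fs_norm :: "(complex \<Rightarrow> complex) \<Rightarrow> real"

definition H_inf :: "(complex \<Rightarrow> real) \<Rightarrow> fun_space" where
  "H_inf v =
     \<lparr>fs_set = {f \<in> hol_disk. bdd_above ((\<lambda>z. v z * cmod (f z)) ` disk)},
      fs_norm = (\<lambda>f. SUP z\<in>disk. v z * cmod (f z))\<rparr>"

definition Bloch :: "(complex \<Rightarrow> real) \<Rightarrow> fun_space" where
  "Bloch v =
     \<lparr>fs_set = {f \<in> hol_disk. on_disk (deriv f) \<in> fs_set (H_inf v)},
      fs_norm = (\<lambda>f. cmod (f 0) + (SUP z\<in>disk. v z * cmod (deriv f z)))\<rparr>"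

definition v_log :: "complex \<Rightarrow> real" where
  "v_log z = (1 - cmod z) * ln (2 / (1 - cmod z))"

definition w_log :: "complex \<Rightarrow> real" where
  "w_log z = inverse (ln (ln (4 / (1 - (cmod z)\<^sup>2))))"

definition W_op ::
  "(complex \<Rightarrow> complex) \<Rightarrow> (complex \<Rightarrow> complex) \<Rightarrow> (complex \<Rightarrow> complex) \<Rightarrow> complex \<Rightarrow> complex" where
  "W_op u \<phi> f = on_disk (\<lambda>z. u z * f (\<phi> z))"

text \<open>
  Operators between two spaces are total functions of which only the values on the domain space
  matter. Scalars are complex.
\<close>

definition linear_op ::
  "fun_space \<Rightarrow> fun_space \<Rightarrow> ((complex \<Rightarrow> complex) \<Rightarrow> complex \<Rightarrow> complex) \<Rightarrow> bool" where
  "linear_op X Y T \<longleftrightarrow>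
     (\<forall>f\<in>fs_set X. T f \<in> fs_set Y) \<and>
     (\<forall>f\<in>fs_set X. \<forall>g\<in>fs_set X. T (\<lambda>z. f z + g z) = (\<lambda>z. T f z + T g z)) \<and>
     (\<forall>c. \<forall>f\<in>fs_set X. T (\<lambda>z. c * f z) = (\<lambda>z. c * T f z))"

definition continuous_linear_op ::
  "fun_space \<Rightarrow> fun_space \<Rightarrow> ((complex \<Rightarrow> complex) \<Rightarrow> complex \<Rightarrow> complex) \<Rightarrow> bool" where
  "continuous_linear_op X Y T \<longleftrightarrow>
     linear_op X Y T \<and>
     (\<forall>f\<in>fs_set X. \<forall>e>0. \<exists>d>0. \<forall>g\<in>fs_set X.
        fs_norm X (\<lambda>z. g z - f z) < d \<longrightarrow> fs_norm Y (\<lambda>z. T g z - T f z) < e)"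

definition compact_linear_op ::
  "fun_space \<Rightarrow> fun_space \<Rightarrow> ((complex \<Rightarrow> complex) \<Rightarrow> complex \<Rightarrow> complex) \<Rightarrow> bool" where
  "compact_linear_op X Y K \<longleftrightarrow>
     linear_op X Y K \<and>
     (\<forall>s :: nat \<Rightarrow> complex \<Rightarrow> complex.
        (\<forall>n. s n \<in> fs_set X) \<and> (\<exists>B. \<forall>n. fs_norm X (s n) \<le> B) \<longrightarrow>
        (\<exists>g\<in>fs_set Y. \<exists>\<rho> :: nat \<Rightarrow> nat. strict_mono \<rho> \<and>
           (\<lambda>n. fs_norm Y (\<lambda>z. K (s (\<rho> n)) z - g z)) \<longlonglongrightarrow> 0))"

text \<open>
  Suprema and infima of operator norms are taken in \<^typ>\<open>ennreal\<close>, so no boundedness side conditions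
  arise.
\<close>

definition op_norm ::
  "fun_space \<Rightarrow> fun_space \<Rightarrow> ((complex \<Rightarrow> complex) \<Rightarrow> complex \<Rightarrow> complex) \<Rightarrow> ennreal" where
  "op_norm X Y T = (SUP f\<in>{f \<in> fs_set X. fs_norm X f \<le> 1}. ennreal (fs_norm Y (T f)))"

definition ess_norm ::
  "fun_space \<Rightarrow> fun_space \<Rightarrow> ((complex \<Rightarrow> complex) \<Rightarrow> complex \<Rightarrow> complex) \<Rightarrow> ennreal" where
  "ess_norm X Y T = (INF K\<in>{K. compact_linear_op X Y K}. op_norm X Y (\<lambda>f z. T f z - K f z))"

end

theory Submission imports Defs
begin

text \<open>
  The bound comes from approximating the operator by its dilations: for \<open>0 \<le> r < 1\<close> put
  \<open>K f = u * f (r \<phi>)\<close>. The range of \<open>r \<phi>\<close> lies in the compact disk of radius \<open>r\<close>, on which a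
  bounded sequence of Bloch functions has a uniformly convergent subsequence by Montel's theorem.
  Since \<open>u\<close>, the image of the constant function one, belongs to the target space, \<open>K\<close> is compact
  (\<open>compact_dilated_composition\<close>).

  The function \<open>G t = ln (ln (2 / (1 - t)))\<close> is a primitive of \<open>1 / v_log\<close> along a radius. Hence
  integrating \<open>f'\<close> from \<open>r z\<close> to \<open>z\<close> gives \<open>\<bar>f z - f (r z)\<bar> \<le> \<parallel>f\<parallel> (G \<bar>z\<bar> - G (r \<bar>z\<bar>))\<close>
  (\<open>Bloch_radial_increment\<close>), and two estimates of the right-hand side, applied at \<open>\<phi> z\<close>,
  control \<open>W f - K f\<close>. Where \<open>\<bar>\<phi> z\<bar> \<le> R\<close>, uniform continuity of \<open>G\<close> on \<open>[0, R]\<close> makes it small for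
  \<open>r\<close> near one. Where \<open>\<bar>\<phi> z\<bar> > R\<close>, it is at most \<open>G \<bar>\<phi> z\<bar> - G 0 \<le> C / w_log (\<phi> z)\<close>
  (\<open>loglog_growth\<close>), which produces the supremum of the theorem. So the essential norm is at most
  \<open>C\<close> times the supremum over \<open>\<bar>\<phi> z\<bar> > R\<close>, for every \<open>R < 1\<close> (\<open>ess_norm_le_tail\<close>). These suprema
  decrease in \<open>R\<close>, so they have a limit. The constant \<open>C = growth_const\<close> is the same for all \<open>u\<close>
  and \<open>\<phi>\<close>.
\<close>

section \<open>The weights\<close>

definition loglog :: "real \<Rightarrow> real" where
  "loglog t = ln (ln (2 / (1 - t)))"

lemma ln_two_over_pos:
  fixes t :: real
  assumes "0 \<le> t" "t < 1"
  shows "0 < ln (2 / (1 - t))"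
  using assms by (simp add: field_simps)

lemma v_log_pos:
  assumes "z \<in> disk"
  shows "0 < v_log z"
  using assms ln_two_over_pos[of "cmod z"] by (simp add: v_log_def)

lemma v_log_nonneg: "z \<in> disk \<Longrightarrow> 0 \<le> v_log z"
  using v_log_pos less_imp_le by blast

lemma loglog_mono:
  assumes "0 \<le> s" "s \<le> t" "t < 1"
  shows "loglog s \<le> loglog t"
proof -
  have "2 / (1 - s) \<le> 2 / (1 - t)"
    using assms by (intro divide_left_mono) auto
  then have "ln (2 / (1 - s)) \<le> ln (2 / (1 - t))"
    using assms by (intro ln_mono) auto
  then show ?thesis
    unfolding loglog_def using ln_two_over_pos[of s] assms by (intro ln_mono) auto
qed

lemma loglog_has_real_derivative:
  assumes "0 \<le> t" "t < 1"
  shows "(loglog has_real_derivative 1 / ((1 - t) * ln (2 / (1 - t)))) (at t)"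
proof -
  have "((\<lambda>t. 2 / (1 - t)) has_real_derivative 2 / (1 - t)\<^sup>2) (at t)"
    using assms by (auto intro!: derivative_eq_intros simp: power2_eq_square)
  from DERIV_ln_divide[THEN DERIV_chain2, OF _ this]
  have "((\<lambda>t. ln (2 / (1 - t))) has_real_derivative 1 / (2 / (1 - t)) * (2 / (1 - t)\<^sup>2)) (at t)"
    using assms by simp
  also have "1 / (2 / (1 - t)) * (2 / (1 - t)\<^sup>2) = 1 / (1 - t)"
    using assms by (simp add: power2_eq_square divide_simps)
  finally have "((\<lambda>t. ln (2 / (1 - t))) has_real_derivative 1 / (1 - t)) (at t)" .
  from DERIV_ln_divide[THEN DERIV_chain2, OF ln_two_over_pos[OF assms] this]
  show ?thesis by (simp add: loglog_def[abs_def] mult.commute)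
qed

lemma continuous_on_loglog: "continuous_on {0..<1} loglog"
  by (rule DERIV_continuous_on, rule has_field_derivative_at_within,
      rule loglog_has_real_derivative) auto

lemma ln_four_gt_one: "1 < ln (4::real)"
proof -
  have "exp 1 < (4::real)" using exp_le by linarith
  then show ?thesis by (metis exp_gt_zero exp_less_cancel_iff exp_ln less_trans)
qed

text \<open>
  The minimum of \<open>1 / w_log\<close>, attained at the origin, is \<open>ln (ln 4) > 0\<close>. Hence
  \<open>- ln (ln 2) / ln (ln 4)\<close> copies of \<open>1 / w_log\<close> absorb the additive constant
  \<open>- loglog 0 = - ln (ln 2) > 0\<close>.
\<close>

definition growth_const :: real where
  "growth_const = 1 - ln (ln 2) / ln (ln 4)"

lemma growth_const_pos: "0 < growth_const"
proof -
  have "ln 2 < (1::real)" by (rule ln_2_less_1)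
  then have "ln (ln (2::real)) < 0" by simp
  moreover have "0 < ln (ln (4::real))" using ln_four_gt_one by simp
  ultimately show ?thesis
    by (simp add: growth_const_def field_simps)
qed

text \<open>
  Since \<open>2 / (1 - t) = 2 (1 + t) / (1 - t\<^sup>2) \<le> 4 / (1 - t\<^sup>2)\<close>, the function \<open>loglog\<close> is at most
  \<open>1 / w_log\<close>; what remains is the constant \<open>- ln (ln 2)\<close>.
\<close>

lemma loglog_growth:
  assumes "z \<in> disk"
  shows "loglog (cmod z) - loglog 0 \<le> growth_const / w_log z"
proof -
  define t where "t = cmod z"
  have t: "0 \<le> t" "t < 1" using assms by (auto simp: t_def)
  have t2: "t\<^sup>2 < 1" using t by (simp add: power_less_one_iff abs_square_less_1)
  define A where "A = ln (ln (4 / (1 - t\<^sup>2)))"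
  have "2 / (1 - t) = 2 * (1 + t) / (1 - t\<^sup>2)"
    using t t2 by (simp add: divide_simps power2_eq_square) (simp add: algebra_simps)
  also have "\<dots> \<le> 4 / (1 - t\<^sup>2)"
    using t t2 by (intro divide_right_mono) auto
  finally have "ln (2 / (1 - t)) \<le> ln (4 / (1 - t\<^sup>2))"
    using t by (intro ln_mono) auto
  then have 1: "loglog t \<le> A"
    unfolding loglog_def A_def using ln_two_over_pos[OF t] by (rule ln_mono)
  have "(4::real) \<le> 4 / (1 - t\<^sup>2)" using t2 by (simp add: field_simps)
  then have "ln 4 \<le> ln (4 / (1 - t\<^sup>2))" by (intro ln_mono) auto
  moreover have "0 < ln (4::real)" using ln_four_gt_one by simp
  ultimately have 2: "ln (ln 4) \<le> A"
    unfolding A_def by (rule ln_mono)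
  have p: "0 < ln (ln (4::real))" using ln_four_gt_one by simp
  have "ln 2 < (1::real)" using ln_2_less_1 by simp
  then have n: "ln (ln (2::real)) < 0" by simp
  have "- ln (ln 2) = (- ln (ln 2) / ln (ln 4)) * ln (ln (4::real))"
    using p by simp
  also have "\<dots> \<le> (- ln (ln 2) / ln (ln 4)) * A"
    using n p 2 by (intro mult_left_mono) (auto simp: divide_nonpos_nonneg)
  finally have "loglog t - loglog 0 \<le> growth_const * A"
    using 1 by (simp add: growth_const_def loglog_def algebra_simps)
  moreover have "w_log z = inverse A" by (simp add: w_log_def A_def t_def)
  ultimately show ?thesis by (simp add: divide_inverse t_def)
qed

section \<open>Growth of logarithmic Bloch functions\<close>

lemma on_disk_in_hol_disk:
  assumes "f holomorphic_on disk"
  shows "on_disk f \<in> hol_disk"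
proof -
  have "on_disk f holomorphic_on disk"
    by (rule holomorphic_transform[OF assms]) (simp add: on_disk_def)
  then show ?thesis by (simp add: hol_disk_def on_disk_def)
qed

lemma Bloch_holomorphic: "f \<in> fs_set (Bloch v) \<Longrightarrow> f holomorphic_on disk"
  by (simp add: Bloch_def hol_disk_def)

lemma Bloch_norm_bounds:
  assumes f: "f \<in> fs_set (Bloch v_log)"
  shows "cmod (f 0) \<le> fs_norm (Bloch v_log) f"
    and "z \<in> disk \<Longrightarrow> cmod (deriv f z) \<le> fs_norm (Bloch v_log) f / v_log z"
proof -
  let ?g = "\<lambda>z. v_log z * cmod (deriv f z)"
  have "bdd_above ((\<lambda>z. v_log z * cmod (on_disk (deriv f) z)) ` disk)"
    using f by (simp add: Bloch_def H_inf_def)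
  moreover have "(\<lambda>z. v_log z * cmod (on_disk (deriv f) z)) ` disk = ?g ` disk"
    by (intro image_cong) (auto simp: on_disk_def)
  ultimately have bdd: "bdd_above (?g ` disk)" by simp
  have le: "?g z \<le> (SUP z\<in>disk. ?g z)" if "z \<in> disk" for z
    by (rule cSUP_upper[OF that bdd])
  have "0 \<le> ?g 0" using v_log_pos[of 0] by simp
  also have "\<dots> \<le> (SUP z\<in>disk. ?g z)" by (rule le) simp
  finally show "cmod (f 0) \<le> fs_norm (Bloch v_log) f"
    by (simp add: Bloch_def)
  show "cmod (deriv f z) \<le> fs_norm (Bloch v_log) f / v_log z" if z: "z \<in> disk"
  proof -
    have "?g z \<le> fs_norm (Bloch v_log) f"
      using le[OF z] by (simp add: Bloch_def add_increasing)
    then show ?thesis using v_log_pos[OF z] by (simp add: field_simps)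
  qed
qed

text \<open>
  Along the segment from \<open>r z\<close> to \<open>z\<close> the derivative of \<open>t \<mapsto> f (t z)\<close> is dominated by that of
  \<open>t \<mapsto> \<parallel>f\<parallel> loglog (t \<bar>z\<bar>)\<close>, and the mean value inequality compares the increments. Working
  with the increment of \<open>loglog\<close> rather than with \<open>f\<close> itself serves both for small and for large
  \<open>\<bar>z\<bar>\<close>.
\<close>

lemma Bloch_radial_increment:
  assumes f: "f \<in> fs_set (Bloch v_log)" and z: "z \<in> disk" and r: "0 \<le> r" "r < 1"
  shows "cmod (f z - f (of_real r * z))
           \<le> fs_norm (Bloch v_log) f * (loglog (cmod z) - loglog (r * cmod z))"
proof -
  define S where "S = fs_norm (Bloch v_log) f"
  have tz: "of_real t * z \<in> disk" "0 \<le> t * cmod z" "t * cmod z < 1"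
    if "t \<in> {r..1}" for t
  proof -
    have "t * cmod z \<le> 1 * cmod z" using that by (intro mult_right_mono) auto
    then show "t * cmod z < 1" using z by simp
    then show "of_real t * z \<in> disk" using that r by (simp add: norm_mult)
    show "0 \<le> t * cmod z" using that r by simp
  qed
  have df: "((\<lambda>t. f (of_real t * z)) has_vector_derivative deriv f (of_real t * z) * z) (at t)"
    if "t \<in> {r..1}" for t
  proof -
    have "(f has_field_derivative deriv f (of_real t * z)) (at (of_real t * z))"
      using Bloch_holomorphic[OF f] tz(1)[OF that] open_ball holomorphic_derivI by blast
    then have "((\<lambda>w. f (w * z)) has_field_derivative deriv f (of_real t * z) * z) (at (of_real t))"
      by (rule DERIV_chain2) (auto intro!: derivative_eq_intros)
    from has_vector_derivative_real_field[OF this] show ?thesis .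
  qed
  have dG: "((\<lambda>t. S * loglog (t * cmod z)) has_real_derivative S / v_log (of_real t * z) * cmod z) (at t)"
    if "t \<in> {r..1}" for t
  proof -
    have "cmod (of_real t * z) = t * cmod z" using that r by (simp add: norm_mult)
    then have "(loglog has_real_derivative 1 / v_log (of_real t * z)) (at (t * cmod z))"
      using loglog_has_real_derivative[OF tz(2,3)[OF that]] by (simp add: v_log_def)
    then have "((\<lambda>t. loglog (t * cmod z)) has_real_derivative 1 / v_log (of_real t * z) * cmod z) (at t)"
      by (rule DERIV_chain2) (auto intro!: derivative_eq_intros)
    from DERIV_cmult[OF this, of S] show ?thesis by simp
  qed
  have "norm (f (of_real 1 * z) - f (of_real r * z))
      \<le> S * loglog (1 * cmod z) - S * loglog (r * cmod z)"
  proof (rule differentiable_bound_general[OF r(2)])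
    show "continuous_on {r..1} (\<lambda>t. f (of_real t * z))"
      by (rule continuous_at_imp_continuous_on)
         (blast intro: has_vector_derivative_continuous df)
    show "continuous_on {r..1} (\<lambda>t. S * loglog (t * cmod z))"
      by (rule continuous_at_imp_continuous_on) (blast intro: DERIV_isCont dG)
    show "((\<lambda>t. f (of_real t * z)) has_vector_derivative deriv f (of_real t * z) * z) (at t)"
      if "r < t" "t < 1" for t using df that by simp
    show "((\<lambda>t. S * loglog (t * cmod z)) has_vector_derivative S / v_log (of_real t * z) * cmod z) (at t)"
      if "r < t" "t < 1" for t
      using dG that by (simp add: has_real_derivative_iff_has_vector_derivative)
    show "norm (deriv f (of_real t * z) * z) \<le> S / v_log (of_real t * z) * cmod z"
      if "r < t" "t < 1" for t
      using Bloch_norm_bounds(2)[OF f tz(1)[of t]] that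
      by (simp add: norm_mult S_def mult_right_mono del: times_divide_eq_left)
  qed
  then show ?thesis by (simp add: S_def algebra_simps)
qed

text \<open>
  Taking \<open>r = 0\<close> in the radial estimate shows that bounded sets of Bloch functions are locally
  bounded, as Montel's theorem requires.
\<close>

lemma Bloch_growth:
  assumes f: "f \<in> fs_set (Bloch v_log)" and z: "cmod z \<le> R" and R: "R < 1"
  shows "cmod (f z) \<le> fs_norm (Bloch v_log) f * (1 + loglog R - loglog 0)"
proof -
  let ?S = "fs_norm (Bloch v_log) f"
  have S: "cmod (f 0) \<le> ?S" by (rule Bloch_norm_bounds[OF f])
  then have S0: "0 \<le> ?S" using norm_ge_zero order_trans by blast
  have "cmod (f z - f 0) \<le> ?S * (loglog (cmod z) - loglog 0)"
    using Bloch_radial_increment[OF f, of z 0] z R by simp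
  also have "\<dots> \<le> ?S * (loglog R - loglog 0)"
    using loglog_mono[of "cmod z" R] z R S0 by (intro mult_left_mono) auto
  finally have "cmod (f z - f 0) \<le> ?S * (loglog R - loglog 0)" .
  then show ?thesis using S norm_triangle_ineq2[of "f z" "f 0"] by (simp add: algebra_simps)
qed

section \<open>Dilated composition operators are compact\<close>

lemma one_in_Bloch: "on_disk (\<lambda>_. 1) \<in> fs_set (Bloch v)"
proof -
  have "deriv (on_disk (\<lambda>_. 1)) z = 0" if "z \<in> disk" for z
  proof -
    have "deriv (on_disk (\<lambda>_. 1)) z = deriv (\<lambda>_. 1) z"
      using that eventually_nhds_in_open[of disk z]
      by (intro deriv_cong_ev) (auto simp: on_disk_def elim!: eventually_mono)
    then show ?thesis by simp
  qed
  then have "on_disk (deriv (on_disk (\<lambda>_. 1))) = (\<lambda>_. 0)"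
    by (auto simp: on_disk_def)
  moreover have "bdd_above ((\<lambda>z::complex. 0::real) ` disk)" by (auto intro!: bdd_aboveI)
  ultimately show ?thesis
    using on_disk_in_hol_disk[of "\<lambda>_. 1"]
    by (simp add: Bloch_def H_inf_def) (simp add: hol_disk_def)
qed

text \<open>
  The supremum in the norm is a real number, with an unspecified and possibly negative value on
  unbounded sets. Bounding its absolute value yields convergence to zero in norm from pointwise
  bounds alone.
\<close>

lemma H_inf_norm_abs_le:
  assumes v: "\<And>z. z \<in> disk \<Longrightarrow> 0 \<le> v z"
    and B: "\<And>z. z \<in> disk \<Longrightarrow> v z * cmod (f z) \<le> B"
  shows "\<bar>fs_norm (H_inf v) f\<bar> \<le> B"
proof -
  let ?S = "SUP z\<in>disk. v z * cmod (f z)"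
  have "?S \<le> B" using B by (intro cSUP_least) auto
  moreover have "v 0 * cmod (f 0) \<le> ?S" using B by (intro cSUP_upper bdd_aboveI2) auto
  moreover have "0 \<le> v 0 * cmod (f 0)" using v[of 0] by simp
  ultimately show ?thesis by (simp add: H_inf_def)
qed

text \<open>
  Composition with \<open>r \<phi>\<close> sees only the values of \<open>f\<close> on the compact disk of radius \<open>r\<close>, where
  Montel's theorem yields uniform convergence; the bound \<open>M\<close> on \<open>v_log \<bar>u\<bar>\<close> turns uniform convergence
  into convergence in norm. Boundedness on that disk alone puts the image of a holomorphic function
  into the target space, so this holds for the Montel limit as well, without any estimate of its
  Bloch norm.
\<close>

lemma compact_dilated_composition:
  fixes u \<phi> :: "complex \<Rightarrow> complex"
  assumes u: "u holomorphic_on disk" and \<phi>: "\<phi> holomorphic_on disk" "\<phi> ` disk \<subseteq> disk"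
    and M: "\<And>z. z \<in> disk \<Longrightarrow> v_log z * cmod (u z) \<le> M"
    and r: "0 \<le> r" "r < 1"
  shows "compact_linear_op (Bloch v_log) (H_inf v_log) (W_op u (\<lambda>z. of_real r * \<phi> z))"
proof -
  define \<psi> where "\<psi> = (\<lambda>z. of_real r * \<phi> z)"
  have \<psi>r: "cmod (\<psi> z) \<le> r" if "z \<in> disk" for z
  proof -
    have "cmod (\<phi> z) \<le> 1" using \<phi>(2) that by (force simp: less_imp_le)
    then show ?thesis using r by (simp add: \<psi>_def norm_mult mult_left_le)
  qed
  then have \<psi>1: "\<psi> ` disk \<subseteq> disk" using r by fastforce
  have hol\<psi>: "\<psi> holomorphic_on disk"
    unfolding \<psi>_def using \<phi>(1) by (intro holomorphic_intros)
  have M0: "0 \<le> M"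
    using M[of 0] v_log_pos[of 0] by (smt (verit) centre_in_ball mult_nonneg_nonneg norm_ge_zero)
  have est: "v_log z * cmod (u z * w) \<le> M * B" if "z \<in> disk" "cmod w \<le> B" for z w B
    using mult_mono[OF M[OF that(1)] that(2) M0] by (simp add: norm_mult mult.assoc)
  have in_H: "W_op u \<psi> f \<in> fs_set (H_inf v_log)"
    if f: "f holomorphic_on disk" and B: "\<And>w. cmod w \<le> r \<Longrightarrow> cmod (f w) \<le> B" for f B
  proof -
    have "(\<lambda>z. f (\<psi> z)) holomorphic_on disk"
      using holomorphic_on_compose_gen[OF hol\<psi> f \<psi>1] by (simp add: o_def)
    then have "(\<lambda>z. u z * f (\<psi> z)) holomorphic_on disk"
      using u by (intro holomorphic_intros)
    then have "W_op u \<psi> f \<in> hol_disk"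
      unfolding W_op_def by (rule on_disk_in_hol_disk)
    moreover have "v_log z * cmod (W_op u \<psi> f z) \<le> M * B" if "z \<in> disk" for z
      using est[OF that B[OF \<psi>r[OF that]]] that by (simp add: W_op_def on_disk_def)
    ultimately show ?thesis
      by (auto simp: H_inf_def intro!: bdd_aboveI2[where M = "M * B"])
  qed
  have "linear_op (Bloch v_log) (H_inf v_log) (W_op u \<psi>)"
    unfolding linear_op_def
  proof (intro conjI ballI allI)
    show "W_op u \<psi> f \<in> fs_set (H_inf v_log)" if "f \<in> fs_set (Bloch v_log)" for f
      by (rule in_H[OF Bloch_holomorphic[OF that] Bloch_growth[OF that _ r(2)]])
  qed (auto simp: W_op_def on_disk_def algebra_simps)
  moreover have "\<exists>g\<in>fs_set (H_inf v_log). \<exists>\<rho> :: nat \<Rightarrow> nat. strict_mono \<rho> \<and>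
           (\<lambda>n. fs_norm (H_inf v_log) (\<lambda>z. W_op u \<psi> (s (\<rho> n)) z - g z)) \<longlonglongrightarrow> 0"
    if s: "\<And>n. s n \<in> fs_set (Bloch v_log)" "\<And>n. fs_norm (Bloch v_log) (s n) \<le> B"
    for s :: "nat \<Rightarrow> complex \<Rightarrow> complex" and B
  proof -
    have locbdd: "\<exists>b. \<forall>h\<in>range s. \<forall>z\<in>K. norm (h z) \<le> b" if K: "compact K" "K \<subseteq> disk" for K
    proof -
      obtain R where R: "0 \<le> R" "R < 1" "\<And>z. z \<in> K \<Longrightarrow> cmod z \<le> R"
      proof (cases "K = {}")
        case True
        then show ?thesis using that[of 0] by simp
      next
        case False
        then obtain x where "x \<in> K" "\<And>z. z \<in> K \<Longrightarrow> cmod z \<le> cmod x"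
          using continuous_attains_sup[OF K(1), of cmod] continuous_on_norm_id by blast
        then show ?thesis using that[of "cmod x"] K(2) by auto
      qed
      have "norm (s n z) \<le> B * (1 + loglog R - loglog 0)" if "z \<in> K" for n z
      proof -
        have "norm (s n z) \<le> fs_norm (Bloch v_log) (s n) * (1 + loglog R - loglog 0)"
          using R that by (intro Bloch_growth[OF s(1)]) auto
        also have "\<dots> \<le> B * (1 + loglog R - loglog 0)"
          using s(2) loglog_mono[of 0 R] R by (intro mult_right_mono) auto
        finally show ?thesis .
      qed
      then show ?thesis by auto
    qed
    obtain g \<rho> where g: "g holomorphic_on disk" and \<rho>: "strict_mono (\<rho> :: nat \<Rightarrow> nat)"
      and unif: "\<And>K. compact K \<Longrightarrow> K \<subseteq> disk \<Longrightarrow> uniform_limit K (s \<circ> \<rho>) g sequentially"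
      by (rule Montel[of disk "range s" s])
        (use locbdd Bloch_holomorphic[OF s(1)] in auto)
    have rdisk: "cball 0 r \<subseteq> disk" using r by auto
    have "continuous_on (cball 0 r) g"
      using g rdisk holomorphic_on_imp_continuous_on holomorphic_on_subset by blast
    then have "bounded (g ` cball 0 r)"
      by (intro compact_imp_bounded compact_continuous_image) auto
    then obtain b where b: "\<And>w. cmod w \<le> r \<Longrightarrow> cmod (g w) \<le> b"
      unfolding bounded_iff by (metis dist_0_norm imageI mem_cball)
    have "(\<lambda>n. fs_norm (H_inf v_log) (\<lambda>z. W_op u \<psi> (s (\<rho> n)) z - W_op u \<psi> g z)) \<longlonglongrightarrow> 0"
    proof (rule LIMSEQ_I)
      fix e :: real assume e: "0 < e"
      \<comment> \<open>The summand one avoids division by zero when \<open>M = 0\<close> and makes the final bound strict.\<close>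
      have "0 < e / (M + 1)" using e M0 by simp
      then have "\<forall>\<^sub>F n in sequentially. \<forall>w\<in>cball 0 r. dist ((s \<circ> \<rho>) n w) (g w) < e / (M + 1)"
        using unif[OF compact_cball rdisk] by (simp only: uniform_limit_iff)
      then obtain N where "\<forall>n\<ge>N. \<forall>w\<in>cball 0 r. dist ((s \<circ> \<rho>) n w) (g w) < e / (M + 1)"
        unfolding eventually_sequentially by blast
      then have N: "cmod (s (\<rho> n) w - g w) < e / (M + 1)" if "N \<le> n" "cmod w \<le> r" for n w
        using that by (simp add: dist_norm)
      have "norm (fs_norm (H_inf v_log) (\<lambda>z. W_op u \<psi> (s (\<rho> n)) z - W_op u \<psi> g z) - 0) < e"
        if n: "N \<le> n" for n
      proof -
        let ?h = "\<lambda>z. W_op u \<psi> (s (\<rho> n)) z - W_op u \<psi> g z"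
        have "v_log z * cmod (?h z) \<le> M * (e / (M + 1))" if z: "z \<in> disk" for z
        proof -
          have "?h z = u z * (s (\<rho> n) (\<psi> z) - g (\<psi> z))"
            using z by (simp add: W_op_def on_disk_def algebra_simps)
          then show ?thesis using est[OF z less_imp_le[OF N[OF n \<psi>r[OF z]]]] by simp
        qed
        from H_inf_norm_abs_le[OF v_log_nonneg this]
        have "\<bar>fs_norm (H_inf v_log) ?h\<bar> \<le> M * (e / (M + 1))" .
        also have "\<dots> < e" using M0 e by (simp add: field_simps)
        finally show ?thesis by simp
      qed
      then show "\<exists>N. \<forall>n\<ge>N. norm (fs_norm (H_inf v_log)
          (\<lambda>z. W_op u \<psi> (s (\<rho> n)) z - W_op u \<psi> g z) - 0) < e"
        by blast
    qed
    then show ?thesis using in_H[OF g b] \<rho> by blast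
  qed
  ultimately show ?thesis
    unfolding compact_linear_op_def \<psi>_def[symmetric] by blast
qed

section \<open>The essential norm\<close>

lemma tendsto_at_left_INF:
  fixes S :: "real \<Rightarrow> ennreal"
  assumes "\<And>r s. r \<le> s \<Longrightarrow> S s \<le> S r"
  shows "(S \<longlongrightarrow> (INF r\<in>{..<a}. S r)) (at_left a)"
proof (rule order_tendstoI)
  fix x assume "x < (INF r\<in>{..<a}. S r)"
  then have "x < S r" if "r < a" for r
    using that by (meson INF_lower lessThan_iff less_le_trans)
  then show "\<forall>\<^sub>F r in at_left a. x < S r"
    by (auto simp: eventually_at_filter)
next
  fix x assume "(INF r\<in>{..<a}. S r) < x"
  then obtain r where "r < a" "S r < x" by (auto simp: INF_less_iff)
  then show "\<forall>\<^sub>F r in at_left a. S r < x"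
    unfolding eventually_at_left_field using assms by (meson le_less_trans less_imp_le)
qed

text \<open>
  Given \<open>R\<close> and \<open>e > 0\<close>, one dilation factor \<open>r\<close> serves all \<open>f\<close> in the unit ball: it is chosen
  from the modulus of continuity of \<open>loglog\<close> on \<open>[0, R]\<close>, so that the points with \<open>\<bar>\<phi> z\<bar> \<le> R\<close>
  contribute at most \<open>e\<close>, while the estimate at the other points holds for every \<open>r\<close>.
\<close>

lemma ess_norm_le_tail:
  fixes u \<phi> :: "complex \<Rightarrow> complex"
  assumes u: "u holomorphic_on disk" and \<phi>: "\<phi> holomorphic_on disk" "\<phi> ` disk \<subseteq> disk"
    and cont: "continuous_linear_op (Bloch v_log) (H_inf v_log) (W_op u \<phi>)"
    and R: "R < 1"
  shows "ess_norm (Bloch v_log) (H_inf v_log) (W_op u \<phi>) \<le> ennreal growth_const *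
     (SUP z\<in>{z \<in> disk. cmod (\<phi> z) > R}. ennreal (v_log z / w_log (\<phi> z) * cmod (u z)))"
    (is "_ \<le> _ * ?T")
proof (cases "?T = top")
  case True
  show ?thesis
    unfolding True using growth_const_pos by (simp add: ennreal_mult_top)
next
  case False
  then obtain s where s: "?T = ennreal s" "0 \<le> s" by (cases ?T) auto
  \<comment> \<open>Testing the operator on the constant function one bounds \<open>v_log \<bar>u\<bar>\<close>.\<close>
  have "W_op u \<phi> (on_disk (\<lambda>_. 1)) \<in> fs_set (H_inf v_log)"
    using cont one_in_Bloch by (simp add: continuous_linear_op_def linear_op_def)
  moreover have "W_op u \<phi> (on_disk (\<lambda>_. 1)) = on_disk u"
    unfolding W_op_def on_disk_def using subsetD[OF \<phi>(2) imageI] by (auto simp del: mem_ball)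
  ultimately have "bdd_above ((\<lambda>z. v_log z * cmod (on_disk u z)) ` disk)"
    by (simp add: H_inf_def)
  then obtain M where "\<forall>z\<in>disk. v_log z * cmod (on_disk u z) \<le> M"
    by (auto simp: bdd_above_def)
  then have M': "v_log z * cmod (u z) \<le> M" if "z \<in> disk" for z
    using that by (auto simp: on_disk_def dest!: bspec[of disk _ z])
  have M0: "0 \<le> M"
    using M'[of 0] v_log_pos[of 0] by (smt (verit) centre_in_ball mult_nonneg_nonneg norm_ge_zero)
  have "ess_norm (Bloch v_log) (H_inf v_log) (W_op u \<phi>) \<le> ennreal (growth_const * s) + ennreal e"
    if e: "0 < e" for e
  proof -
    have "uniformly_continuous_on {0..R} loglog"
      using R by (intro compact_uniformly_continuous continuous_on_subset[OF continuous_on_loglog]) auto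
    moreover have "0 < e / (M + 1)" using e M0 by simp
    ultimately have "\<exists>d>0. \<forall>a\<in>{0..R}. \<forall>b\<in>{0..R}. dist b a < d \<longrightarrow> dist (loglog b) (loglog a) < e / (M + 1)"
      unfolding uniformly_continuous_on_def by blast
    then obtain d where d: "0 < d"
      "\<And>a b. a \<in> {0..R} \<Longrightarrow> b \<in> {0..R} \<Longrightarrow> dist b a < d \<Longrightarrow> dist (loglog b) (loglog a) < e / (M + 1)"
      by blast
    define r where "r = max 0 (1 - d / 2)"
    have r: "0 \<le> r" "r < 1" "1 - r < d" using d(1) by (auto simp: r_def)
    let ?K = "W_op u (\<lambda>z. of_real r * \<phi> z)"
    have "fs_norm (H_inf v_log) (\<lambda>z. W_op u \<phi> f z - ?K f z) \<le> growth_const * s + e"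
      if f: "f \<in> fs_set (Bloch v_log)" "fs_norm (Bloch v_log) f \<le> 1" for f
    proof (rule order_trans[OF abs_ge_self H_inf_norm_abs_le[OF v_log_nonneg]])
      fix z assume z: "z \<in> disk"
      define t where "t = cmod (\<phi> z)"
      have \<phi>z: "\<phi> z \<in> disk" using \<phi>(2) z by blast
      then have t: "0 \<le> t" "t < 1" by (auto simp: t_def)
      have rt: "0 \<le> r * t" "r * t \<le> t" using r t by (auto simp: mult_left_le_one_le)
      define \<Delta> where "\<Delta> = loglog t - loglog (r * t)"
      have \<Delta>0: "0 \<le> \<Delta>" using loglog_mono[OF rt t(2)] by (simp add: \<Delta>_def)
      have "cmod (f (\<phi> z) - f (of_real r * \<phi> z)) \<le> fs_norm (Bloch v_log) f * \<Delta>"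
        using Bloch_radial_increment[OF f(1) \<phi>z r(1,2)] by (simp add: \<Delta>_def t_def)
      also have "\<dots> \<le> 1 * \<Delta>" by (rule mult_right_mono[OF f(2) \<Delta>0])
      finally have inc: "cmod (f (\<phi> z) - f (of_real r * \<phi> z)) \<le> \<Delta>" by simp
      have vu: "0 \<le> v_log z * cmod (u z)" using v_log_pos[OF z] by simp
      have "v_log z * cmod (W_op u \<phi> f z - ?K f z)
          = (v_log z * cmod (u z)) * cmod (f (\<phi> z) - f (of_real r * \<phi> z))"
        using z by (simp add: W_op_def on_disk_def norm_mult flip: right_diff_distrib)
      also have "\<dots> \<le> (v_log z * cmod (u z)) * \<Delta>" by (rule mult_left_mono[OF inc vu])
      also have "\<dots> \<le> growth_const * s + e"
      proof (cases "t \<le> R")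
        case True
        have "t - r * t = (1 - r) * t" by (simp add: algebra_simps)
        also have "\<dots> \<le> 1 - r" using r t by (intro mult_left_le) auto
        finally have "dist t (r * t) < d" using r rt by (simp add: dist_real_def)
        then have "dist (loglog t) (loglog (r * t)) < e / (M + 1)"
          using d(2)[of "r * t" t] True t rt by auto
        then have "\<Delta> \<le> e / (M + 1)" by (simp add: \<Delta>_def dist_real_def)
        then have "(v_log z * cmod (u z)) * \<Delta> \<le> M * (e / (M + 1))"
          using M'[OF z] M0 \<Delta>0 by (intro mult_mono) auto
        also have "\<dots> \<le> e" using M0 e by (simp add: field_simps)
        also have "\<dots> \<le> growth_const * s + e" using growth_const_pos s by simp
        finally show ?thesis .
      next
        case False
        have "\<Delta> \<le> loglog t - loglog 0" using loglog_mono[of 0 "r * t"] rt t by (simp add: \<Delta>_def)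
        also have "\<dots> \<le> growth_const / w_log (\<phi> z)"
          using loglog_growth[OF \<phi>z] by (simp add: t_def)
        finally have "(v_log z * cmod (u z)) * \<Delta>
            \<le> (v_log z * cmod (u z)) * (growth_const / w_log (\<phi> z))"
          by (rule mult_left_mono[OF _ vu])
        also have "\<dots> = growth_const * (v_log z / w_log (\<phi> z) * cmod (u z))" by simp
        also have "\<dots> \<le> growth_const * s"
        proof (rule mult_left_mono)
          have "ennreal (v_log z / w_log (\<phi> z) * cmod (u z)) \<le> ennreal s"
            unfolding s(1)[symmetric] using z False by (intro SUP_upper) (auto simp: t_def)
          then show "v_log z / w_log (\<phi> z) * cmod (u z) \<le> s"
            using s(2) by (simp add: ennreal_le_iff)
        qed (use growth_const_pos in simp)
        finally show ?thesis using e by simp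
      qed
      finally show "v_log z * cmod (W_op u \<phi> f z - ?K f z) \<le> growth_const * s + e" .
    qed
    then have "op_norm (Bloch v_log) (H_inf v_log) (\<lambda>f z. W_op u \<phi> f z - ?K f z)
        \<le> ennreal (growth_const * s + e)"
      unfolding op_norm_def by (intro SUP_least ennreal_leI) auto
    also have "\<dots> = ennreal (growth_const * s) + ennreal e"
      using growth_const_pos s e by (intro ennreal_plus) auto
    finally have K_bound: "op_norm (Bloch v_log) (H_inf v_log) (\<lambda>f z. W_op u \<phi> f z - ?K f z)
        \<le> ennreal (growth_const * s) + ennreal e" .
    have "ess_norm (Bloch v_log) (H_inf v_log) (W_op u \<phi>)
        \<le> op_norm (Bloch v_log) (H_inf v_log) (\<lambda>f z. W_op u \<phi> f z - ?K f z)"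
      unfolding ess_norm_def
      by (rule INF_lower) (rule CollectI, rule compact_dilated_composition[OF u \<phi> M' r(1,2)])
    then show ?thesis using K_bound by (rule order_trans)
  qed
  then have "ess_norm (Bloch v_log) (H_inf v_log) (W_op u \<phi>) \<le> ennreal (growth_const * s)"
    by (rule ennreal_le_epsilon)
  then show ?thesis using s growth_const_pos by (simp add: ennreal_mult)
qed

theorem theorem3p1:
  fixes u \<phi> :: "complex \<Rightarrow> complex"
  assumes "u holomorphic_on disk"
    and "\<phi> holomorphic_on disk" and "\<phi> ` disk \<subseteq> disk"
    and "continuous_linear_op (Bloch v_log) (H_inf v_log) (W_op u \<phi>)"
  shows "\<exists>C::real. C > 0 \<and>
    (\<exists>L::ennreal.
      ((\<lambda>r::real. SUP z\<in>{z \<in> disk. cmod (\<phi> z) > r}.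
          ennreal (v_log z / w_log (\<phi> z) * cmod (u z))) \<longlongrightarrow> L) (at_left 1) \<and>
      ess_norm (Bloch v_log) (H_inf v_log) (W_op u \<phi>) \<le> ennreal C * L)"
proof -
  let ?S = "\<lambda>r::real. SUP z\<in>{z \<in> disk. cmod (\<phi> z) > r}.
          ennreal (v_log z / w_log (\<phi> z) * cmod (u z))"
  let ?L = "INF r\<in>{..<1}. ?S r"
  have lim: "(?S \<longlongrightarrow> ?L) (at_left 1)"
    by (intro tendsto_at_left_INF SUP_subset_mono) auto
  have "ess_norm (Bloch v_log) (H_inf v_log) (W_op u \<phi>) \<le> ennreal growth_const * ?L"
  proof (rule tendsto_lowerbound)
    show "((\<lambda>r. ennreal growth_const * ?S r) \<longlongrightarrow> ennreal growth_const * ?L) (at_left 1)"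
      using lim by (intro ennreal_tendsto_cmult) auto
    show "\<forall>\<^sub>F r in at_left 1. ess_norm (Bloch v_log) (H_inf v_log) (W_op u \<phi>)
        \<le> ennreal growth_const * ?S r"
      using ess_norm_le_tail[OF assms] by (auto simp: eventually_at_filter)
  qed simp
  with lim growth_const_pos show ?thesis by blast
qed

end
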